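(* For any partition $P$ of a positive integer $n$, $\min(\lambda_U(P))=\mu(P)$.
   Context: Partitions and poset. Write a partition as $P=(p_s^{n_s},\dots,p_1^{n_1})$ with $p_s>\cdots>p_1\ge 1$ and $n_i\ge 1$, where $n_i$ is the multiplicity of the part $p_i$. The poset $\mathcal{D}_P$ has as elements the triples $(u,p_i,k)$ with $1\le i\le s$, $1\le u\le p_i$, $1\le k\le n_i$ (so $|\mathcal{D}_P|=n$ if $P\vdash n$). Its order is the partial order with the following covering relations: $(v,p_j,\ell)$ covers $(u,p_i,k)$ if and only if one of the following holds: ($\alpha$) $j=i+1$, $v=u+p_{i+1}-p_i$, $\ell=1$, $k=n_i$; ($\beta$) $j=i-1$, $v=u$, $\ell=1$, $k=n_i$; ($e$) $j=i$, $v=u$, $\ell=k+1$; ($\omega$) $j=i$, neither $p_i+1$ nor $p_i-1$ is a part of $P$, $v=u+1$, $\ell=1$, $k=n_i$. $U$-chains and $\lambda_U(P)$. For a positive integer $m$ and a set $A=\{a_1,a_1+1,\dots,a_m,a_m+1\}\subset\mathbb{N}$ with $a_1<a_1+1<a_2<a_2+1<\cdots<a_m<a_m+1$, the $m$-$U$-chain is $U_A=\bigcup_{i=1}^m S_{A;i}$, where $$S_{A;i}=\{(u,p,k)\in\mathcal{D}_P : p\in\{a_i,a_i+1\},\ i\le u\le p-i+1\}\cup\{(u,p,k)\in\mathcal{D}_P : p>a_i+1,\ u\in\{i,p-i+1\}\}.$$ Let $u_0=0$ and, for $k\ge1$, let $u_k$ be the maximum cardinality of a $k$-$U$-chain in $\mathcal{D}_P$.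 Then $\lambda_U(P)=(\lambda_{U,1},\lambda_{U,2},\dots)$ with $\lambda_{U,k}=u_k-u_{k-1}$. It has exactly $r(P)$ (nonzero) parts (with $r(P)$ defined below), and $\min(\lambda_U(P))=\lambda_{U,r(P)}$. The number $r(P)$. A partition is almost rectangular if its largest and smallest parts differ by at most $1$. $r(P)$ is the minimum number of almost rectangular subpartitions in a decomposition of $P$ as a union (multiset union of parts) of almost rectangular subpartitions. The invariant $\mu(P)$. An $s$-spread (or spread) is a partition $P=(p_s^{n_s},\dots,p_1^{n_1})$ with $p_1>0$, $p_{i+1}=p_i+1$ for $1\le i<s$, and $n_i>0$ for all $i$; then $r(P)=\lceil s/2\rceil$. For an $s$-spread with smallest part $p=p_1$, put $n_{s+1}=0$ and $\mu(P)=\min\{p\,n_{2i-1}+(p+1)\,n_{2j} : 1\le i\le j\le r(P)\}$. For an arbitrary partition write $P=P_\ell\cup\cdots\cup P_1$ where each $P_k$ is a spread and the largest part of $P_k$ is at most the smallest part of $P_{k+1}$ minus $2$. With $\bar r_k=\sum_{i=1}^{k-1} r(P_i)$, define $\mu(P)=\min\{\mu(P_k-2\bar r_k): 1\le k\le \ell\}$, where $P-c$ denotes the partition obtained from $P$ by subtracting $c$ from each part. *)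

theory Defs
  imports "HOL-Library.Multiset"
begin

section \<open>Partitions\<close>

text \<open>A partition is the multiset of its (positive) parts; \<open>count P p\<close> is the multiplicity of \<open>p\<close>.\<close>

definition partition_of :: "nat \<Rightarrow> nat multiset \<Rightarrow> bool" where
  "partition_of n P \<longleftrightarrow> 0 \<notin># P \<and> sum_mset P = n"

definition almost_rectangular :: "nat multiset \<Rightarrow> bool" where
  "almost_rectangular Q \<longleftrightarrow> Q \<noteq> {#} \<and> Max (set_mset Q) - Min (set_mset Q) \<le> 1"

definition r_P :: "nat multiset \<Rightarrow> nat" where
  "r_P P = (LEAST k. \<exists>M :: nat multiset multiset.
     \<Sum>\<^sub># M = P \<and> (\<forall>Q \<in># M. almost_rectangular Q) \<and> size M = k)"

section \<open>U-chains\<close>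

text \<open>
  Only the underlying set of the poset \<open>\<D>\<^sub>P\<close> is needed: neither the U-chains nor
  their cardinalities refer to the order.
\<close>

definition poset_D :: "nat multiset \<Rightarrow> (nat \<times> nat \<times> nat) set" where
  "poset_D P = {(u, p, k). p \<in># P \<and> 1 \<le> u \<and> u \<le> p \<and> 1 \<le> k \<and> k \<le> count P p}"

text \<open>
  A set \<open>A = {a\<^sub>1, a\<^sub>1 + 1, \<dots>, a\<^sub>m, a\<^sub>m + 1}\<close> is given by the function \<open>a\<close> on \<open>{1..m}\<close>;
  values of \<open>a\<close> outside \<open>{1..m}\<close> play no role. As \<open>\<nat>\<close> is taken to contain \<open>0\<close>, \<open>a\<^sub>1 = 0\<close> is
  allowed; replacing an initial run \<open>0, 2, 4, \<dots>\<close> of \<open>a\<close> by \<open>1, 3, 5, \<dots>\<close> gives at least as large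
  a U-chain, so this does not change the maximal cardinalities.
\<close>

definition U_index :: "nat \<Rightarrow> (nat \<Rightarrow> nat) \<Rightarrow> bool" where
  "U_index m a \<longleftrightarrow> (\<forall>i. 1 \<le> i \<and> i < m \<longrightarrow> a i + 1 < a (i + 1))"

text \<open>
  The conditions \<open>u \<le> p - i + 1\<close> and \<open>u = p - i + 1\<close> are written without subtraction, so
  that they have their integer meaning also when \<open>i > p\<close>.
\<close>

definition U_part :: "nat multiset \<Rightarrow> (nat \<Rightarrow> nat) \<Rightarrow> nat \<Rightarrow> (nat \<times> nat \<times> nat) set" where
  "U_part P a i =
     {(u, p, k). (u, p, k) \<in> poset_D P \<and> p \<in> {a i, a i + 1} \<and> i \<le> u \<and> u + i \<le> p + 1} \<union>
     {(u, p, k). (u, p, k) \<in> poset_D P \<and> p > a i + 1 \<and> (u = i \<or> u + i = p + 1)}"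

definition U_chain :: "nat multiset \<Rightarrow> nat \<Rightarrow> (nat \<Rightarrow> nat) \<Rightarrow> (nat \<times> nat \<times> nat) set" where
  "U_chain P m a = (\<Union>i\<in>{1..m}. U_part P a i)"

definition u_max :: "nat multiset \<Rightarrow> nat \<Rightarrow> nat" where
  "u_max P k = (if k = 0 then 0 else Max {card (U_chain P k a) | a. U_index k a})"

text \<open>The subtraction does not truncate, see \<open>u_max_mono\<close> below.\<close>

definition lambda_U :: "nat multiset \<Rightarrow> nat \<Rightarrow> nat" where
  "lambda_U P k = u_max P k - u_max P (k - 1)"

text \<open>The smallest part is the smallest nonzero entry; entries are numbered from \<open>1\<close>.\<close>

definition min_part :: "(nat \<Rightarrow> nat) \<Rightarrow> nat" where
  "min_part l = Min {l k | k. 1 \<le> k \<and> l k \<noteq> 0}"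

section \<open>The invariant mu\<close>

definition is_spread :: "nat multiset \<Rightarrow> bool" where
  "is_spread P \<longleftrightarrow> (\<exists>p s. 1 \<le> p \<and> 1 \<le> s \<and> set_mset P = {p..<p + s})"

text \<open>
  In an \<open>s\<close>-spread with smallest part \<open>p\<close> the \<open>i\<close>-th part is \<open>p + i - 1\<close>, so its multiplicity
  \<open>n\<^sub>i\<close> is given by \<open>spread_mult\<close>, which also gives \<open>n\<^bsub>s+1\<^esub> = 0\<close>.
\<close>

definition spread_mult :: "nat multiset \<Rightarrow> nat \<Rightarrow> nat" where
  "spread_mult P i = count P (Min (set_mset P) + i - 1)"

definition mu_spread :: "nat multiset \<Rightarrow> nat" where
  "mu_spread P = (let p = Min (set_mset P) in
     Min {p * spread_mult P (2 * i - 1) + (p + 1) * spread_mult P (2 * j) | i j.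
            1 \<le> i \<and> i \<le> j \<and> j \<le> r_P P})"

text \<open>The list \<open>[P\<^sub>1, \<dots>, P\<^sub>l]\<close> of spreads, from small parts to large ones.\<close>

definition is_spread_decomp :: "nat multiset \<Rightarrow> nat multiset list \<Rightarrow> bool" where
  "is_spread_decomp P Ps \<longleftrightarrow> sum_list Ps = P \<and> (\<forall>Q \<in> set Ps. is_spread Q) \<and>
     (\<forall>k. Suc k < length Ps \<longrightarrow> Max (set_mset (Ps ! k)) + 2 \<le> Min (set_mset (Ps ! Suc k)))"

text \<open>Existence and uniqueness are shown in \<open>ex1_spread_decomp\<close> below.\<close>

definition spread_decomp :: "nat multiset \<Rightarrow> nat multiset list" where
  "spread_decomp P = (THE Ps. is_spread_decomp P Ps)"

text \<open>
  \<open>r_bar Ps k\<close> is the sum of the numbers \<open>r(P\<^sub>i)\<close> over the \<open>k\<close> spreads preceding the entry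
  \<open>Ps ! k\<close> (list positions start at \<open>0\<close>).
\<close>

definition r_bar :: "nat multiset list \<Rightarrow> nat \<Rightarrow> nat" where
  "r_bar Ps k = (\<Sum>i<k. r_P (Ps ! i))"

text \<open>
  When used in \<open>mu\<close>, the subtraction does not truncate and leaves positive parts: an \<open>s\<close>-spread
  has \<open>r = \<lceil>s/2\<rceil>\<close>, and the smallest part of the next spread exceeds its smallest part by at
  least \<open>s + 1 \<ge> 2 r\<close>.
\<close>

definition shift_down :: "nat multiset \<Rightarrow> nat \<Rightarrow> nat multiset" where
  "shift_down P c = image_mset (\<lambda>p. p - c) P"

definition mu :: "nat multiset \<Rightarrow> nat" where
  "mu P = (let Ps = spread_decomp P in
     Min {mu_spread (shift_down (Ps ! k) (2 * r_bar Ps k)) | k. k < length Ps})"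

section \<open>Well-definedness\<close>

lemma finite_poset_D: "finite (poset_D P)"
proof (rule finite_subset)
  show "poset_D P \<subseteq> (\<Union>p\<in>set_mset P. {..p} \<times> {p} \<times> {..count P p})"
    by (auto simp: poset_D_def)
qed auto

lemma U_chain_subset: "U_chain P m a \<subseteq> poset_D P"
  by (auto simp: U_chain_def U_part_def)

lemma finite_U_cards: "finite {card (U_chain P k a) | a. U_index k a}"
  by (rule finite_subset[of _ "{..card (poset_D P)}"])
     (use card_mono[OF finite_poset_D U_chain_subset] in auto)

lemma U_cards_nonempty: "{card (U_chain P k a) | a. U_index k a} \<noteq> {}"
proof -
  have "U_index k (\<lambda>i. 2 * i)" by (auto simp: U_index_def)
  then show ?thesis by blast
qed

lemma u_max_mono: "u_max P k \<le> u_max P (Suc k)"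
proof (cases "k = 0")
  case False
  from Max_in[OF finite_U_cards U_cards_nonempty, of P k] False
  obtain a where a: "U_index k a" "u_max P k = card (U_chain P k a)"
    by (auto simp: u_max_def)
  define b where "b = a(Suc k := a k + 2)"
  have "U_index (Suc k) b"
    using a(1) by (auto simp: U_index_def b_def less_Suc_eq)
  then have "card (U_chain P (Suc k) b) \<le> u_max P (Suc k)"
    unfolding u_max_def by (auto intro!: Max_ge finite_U_cards)
  moreover have "U_chain P k a \<subseteq> U_chain P (Suc k) b"
    unfolding U_chain_def by (intro UN_mono) (auto simp: U_part_def b_def)
  then have "card (U_chain P k a) \<le> card (U_chain P (Suc k) b)"
    by (intro card_mono) (auto intro: finite_subset[OF U_chain_subset finite_poset_D])
  ultimately show ?thesis using a(2) by simp
qed (simp add: u_max_def)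

lemma is_spread_decomp_Cons:
  "is_spread_decomp P (Q # Ps) \<longleftrightarrow> is_spread Q \<and>
     (Ps \<noteq> [] \<longrightarrow> Max (set_mset Q) + 2 \<le> Min (set_mset (hd Ps))) \<and>
     (\<exists>R. P = Q + R \<and> is_spread_decomp R Ps)"
proof -
  define G where "G A B \<longleftrightarrow> Max (set_mset A) + 2 \<le> Min (set_mset B)" for A B :: "nat multiset"
  have "(\<forall>k. Suc k < length (Q # Ps) \<longrightarrow> G ((Q # Ps) ! k) ((Q # Ps) ! Suc k)) \<longleftrightarrow>
        (Ps \<noteq> [] \<longrightarrow> G Q (hd Ps)) \<and> (\<forall>k. Suc k < length Ps \<longrightarrow> G (Ps ! k) (Ps ! Suc k))"
    (is "?L \<longleftrightarrow> ?R")
  proof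
    assume L: ?L
    show ?R
    proof (intro conjI impI allI)
      assume "Ps \<noteq> []"
      then show "G Q (hd Ps)" using L[rule_format, of 0] by (simp add: hd_conv_nth)
    next
      fix k assume "Suc k < length Ps"
      then show "G (Ps ! k) (Ps ! Suc k)" using L[rule_format, of "Suc k"] by simp
    qed
  next
    assume R: ?R
    show ?L
    proof (intro allI impI)
      fix k assume "Suc k < length (Q # Ps)"
      then show "G ((Q # Ps) ! k) ((Q # Ps) ! Suc k)"
        using R by (cases k) (auto simp: hd_conv_nth)
    qed
  qed
  then show ?thesis by (auto simp: is_spread_decomp_def G_def)
qed

lemma is_spread_decomp_gap:
  assumes "is_spread_decomp P (Q # Ps)" and "x \<in># Q" and "y \<in># sum_list Ps"
  shows "x + 2 \<le> y"
  using assms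
proof (induction Ps arbitrary: P Q x)
  case (Cons Q' Ps)
  from Cons.prems(1) obtain R where R: "is_spread_decomp R (Q' # Ps)"
    and gap: "Max (set_mset Q) + 2 \<le> Min (set_mset Q')"
    by (subst (asm) is_spread_decomp_Cons) auto
  have ne: "Q' \<noteq> {#}" using R by (auto simp: is_spread_decomp_def is_spread_def)
  have le: "x + 2 \<le> z" if "z \<in># Q'" for z
  proof -
    have "x + 2 \<le> Max (set_mset Q) + 2" using Cons.prems(2) by simp
    also note gap
    also have "Min (set_mset Q') \<le> z" using that by simp
    finally show ?thesis .
  qed
  show ?case
  proof (cases "y \<in># Q'")
    case False
    with Cons.prems(3) have y: "y \<in># sum_list Ps" by simp
    obtain z where z: "z \<in># Q'" using ne by auto
    from Cons.IH[OF R z y] le[OF z] show ?thesis by simp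
  qed (use le in blast)
qed simp

text \<open>The spread of smallest parts is determined by the first gap in the parts.\<close>

lemma is_spread_decomp_head:
  assumes "is_spread_decomp P (Q # Ps)"
  defines "p \<equiv> Min (set_mset P)"
  shows "Q = filter_mset (\<lambda>x. x < (LEAST g. p \<le> g \<and> g \<notin># P)) P"
proof -
  have P: "P = Q + sum_list Ps" using assms(1) by (auto simp: is_spread_decomp_def)
  from assms(1) have "is_spread Q" by (auto simp: is_spread_decomp_def)
  then obtain q s where q: "1 \<le> s" "set_mset Q = {q..<q + s}" by (auto simp: is_spread_def)
  have last: "q + s - 1 \<in># Q" and first: "q \<in># Q" using q by auto
  have big: "q + s < y" if "y \<in># sum_list Ps" for y
    using is_spread_decomp_gap[OF assms(1) last that] q(1) by simp
  have "p = q" unfolding p_def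
  proof (rule Min_eqI)
    show "q \<le> y" if "y \<in> set_mset P" for y
      using that big q by (force simp: P)
    show "q \<in> set_mset P" using first by (simp add: P)
  qed simp
  moreover have "(LEAST g. q \<le> g \<and> g \<notin># P) = q + s"
  proof (rule Least_equality)
    show "q \<le> q + s \<and> q + s \<notin># P" using big q(2) by (auto simp: P)
    show "q + s \<le> g" if "q \<le> g \<and> g \<notin># P" for g
      using that q(2) by (force simp: P)
  qed
  moreover have "filter_mset (\<lambda>x. x < q + s) (sum_list Ps) = {#}"
    unfolding filter_mset_eq_mempty_iff by (intro allI impI, drule big) simp
  moreover have "filter_mset (\<lambda>x. x < q + s) Q = Q"
    using q(2) by (auto simp: filter_mset_eq_conv)
  ultimately show ?thesis by (simp add: P)
qed

lemma is_spread_decomp_unique: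
  "is_spread_decomp P Ps \<Longrightarrow> is_spread_decomp P Ps' \<Longrightarrow> Ps = Ps'"
proof (induction Ps arbitrary: P Ps')
  case Nil
  then show ?case by (cases Ps') (auto simp: is_spread_decomp_def is_spread_def)
next
  case (Cons Q Ps)
  show ?case
  proof (cases Ps')
    case Nil
    with Cons.prems show ?thesis by (auto simp: is_spread_decomp_def is_spread_def)
  next
    case (Cons Q' Qs)
    have "Q = Q'"
      using is_spread_decomp_head[OF Cons.prems(1)]
        is_spread_decomp_head[OF Cons.prems(2)[unfolded Cons]] by simp
    moreover from this have "Ps = Qs"
      using Cons.prems Cons.IH unfolding Cons by (auto simp: is_spread_decomp_Cons)
    ultimately show ?thesis using Cons by simp
  qed
qed

lemma is_spread_decomp_exists: "0 \<notin># P \<Longrightarrow> \<exists>Ps. is_spread_decomp P Ps"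
proof (induction "size P" arbitrary: P rule: less_induct)
  case less
  show ?case
  proof (cases "P = {#}")
    case True
    then have "is_spread_decomp P []" by (simp add: is_spread_decomp_def)
    then show ?thesis ..
  next
    case False
    define p where "p = Min (set_mset P)"
    define g where "g = (LEAST g. p \<le> g \<and> g \<notin># P)"
    define Q where "Q = filter_mset (\<lambda>x. x < g) P"
    define R where "R = filter_mset (\<lambda>x. \<not> x < g) P"
    have P: "P = Q + R" unfolding Q_def R_def by (rule multiset_partition)
    have pP: "p \<in># P" using False by (simp add: p_def)
    have pmin: "p \<le> x" if "x \<in># P" for x using that by (simp add: p_def)
    have "p \<le> Suc (Max (set_mset P)) \<and> Suc (Max (set_mset P)) \<notin># P"
      using pmin[of "Max (set_mset P)"] False Max_ge[of "set_mset P" "Suc (Max (set_mset P))"]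
      by (auto simp: le_SucI simp del: Max_ge)
    then have g: "p \<le> g" "g \<notin># P"
      using LeastI[of "\<lambda>g. p \<le> g \<and> g \<notin># P"] unfolding g_def by blast+
    have gP: "x \<in># P" if "p \<le> x" "x < g" for x
      using that not_less_Least[of x "\<lambda>g. p \<le> g \<and> g \<notin># P"] unfolding g_def by blast
    have "p < g" using g pP by (cases "p = g") auto
    have Q: "set_mset Q = {p..<p + (g - p)}"
      using g gP pmin by (auto simp: Q_def)
    have "p \<noteq> 0" using pP less.prems by (cases "p = 0") auto
    with \<open>p < g\<close> have "1 \<le> p" "1 \<le> g - p" by linarith+
    with Q have spread: "is_spread Q" unfolding is_spread_def by blast
    have ne: "Q \<noteq> {#}" using Q \<open>p < g\<close> by fastforce
    then have "size R < size P" by (simp add: P nonempty_has_size[symmetric])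
    moreover have "0 \<notin># R" using less.prems by (simp add: R_def)
    ultimately obtain Ps where Ps: "is_spread_decomp R Ps" using less.hyps by blast
    have "Max (set_mset Q) + 2 \<le> Min (set_mset (hd Ps))" if "Ps \<noteq> []"
    proof -
      from that Ps obtain H T where H: "Ps = H # T" "R = H + sum_list T" "is_spread H"
        by (cases Ps) (auto simp: is_spread_decomp_def)
      then have "H \<noteq> {#}" by (auto simp: is_spread_def)
      then have "Min (set_mset H) \<in># R" using H by (simp add: Min_in)
      then have "g < Min (set_mset H)" using g(2)
        by (auto simp: R_def le_less not_less)
      moreover have "Max (set_mset Q) < g"
        using ne by (subst Max_less_iff) (auto simp: Q_def)
      ultimately show ?thesis using H(1) by simp
    qed
    with spread Ps P have "is_spread_decomp P (Q # Ps)"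
      by (auto simp: is_spread_decomp_Cons)
    then show ?thesis ..
  qed
qed

lemma ex1_spread_decomp: "0 \<notin># P \<Longrightarrow> \<exists>!Ps. is_spread_decomp P Ps"
  using is_spread_decomp_exists is_spread_decomp_unique by blast

end

theory Submission
  imports Defs
begin

text \<open>
  The complement of \<open>U\<^sub>A\<close> contains, for each copy of a part \<open>p \<notin> A\<close>, exactly \<open>p - 2 c\<close> elements,
  where \<open>c\<close> is the number of pairs (dominoes) of \<open>A\<close> below \<open>p\<close>; copies of parts in \<open>A\<close> lie in
  \<open>U\<^sub>A\<close>. So \<open>n - u\<^sub>k\<close> is the least loss of a family of \<open>k\<close> dominoes. Let \<open>c\<^sub>1 < \<dots> < c\<^sub>r\<close> be the
  first parts of the dominoes that cover each spread greedily from its smallest part. Every family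
  of \<open>r - 1\<close> dominoes misses some \<open>c\<^sub>i\<close> and some \<open>c\<^sub>j + 1\<close>, \<open>i \<le> j\<close>, of the same spread, and
  covering everything else is possible; this gives \<open>n - u\<^bsub>r-1\<^esub> = \<mu>(P)\<close>. Finally, exchanging tails
  between an optimal family of \<open>k - 1 < r\<close> dominoes and the full cover gives families of \<open>k\<close> and of
  \<open>r - 1\<close> dominoes with at most the same total loss, hence \<open>u\<^sub>k - u\<^bsub>k-1\<^esub> \<ge> n - u\<^bsub>r-1\<^esub>\<close>.
\<close>

section \<open>Dominoes and the loss of a part\<close>

definition covered :: "nat \<Rightarrow> (nat \<Rightarrow> nat) \<Rightarrow> nat \<Rightarrow> bool" where
  "covered m a p \<longleftrightarrow> (\<exists>i\<in>{1..m}. p = a i \<or> p = a i + 1)"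

definition below :: "nat \<Rightarrow> (nat \<Rightarrow> nat) \<Rightarrow> nat \<Rightarrow> nat" where
  "below m a p = card {i \<in> {1..m}. a i + 1 < p}"

text \<open>The truncated subtraction is intended: once the values \<open>u = i\<close> and
  \<open>u = p + 1 - i\<close> of the dominoes below \<open>p\<close> exhaust the range from 1 to
  \<open>p\<close>, nothing is lost.\<close>

definition part_loss :: "nat \<Rightarrow> (nat \<Rightarrow> nat) \<Rightarrow> nat \<Rightarrow> nat" where
  "part_loss m a p = (if covered m a p then 0 else p - 2 * below m a p)"

definition loss :: "nat multiset \<Rightarrow> nat \<Rightarrow> (nat \<Rightarrow> nat) \<Rightarrow> nat" where
  "loss P m a = (\<Sum>p\<in>set_mset P. count P p * part_loss m a p)"

definition domino_cover :: "nat multiset \<Rightarrow> nat \<Rightarrow> (nat \<Rightarrow> nat) \<Rightarrow> bool" where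
  "domino_cover P r c \<longleftrightarrow> U_index r c \<and> (\<forall>p. p \<in># P \<longrightarrow> covered r c p)"

text \<open>For the greedy cover \<open>c\<close>, this says that \<open>c i\<close> and \<open>c j\<close> lie in the same spread.\<close>

definition linked :: "nat multiset \<Rightarrow> (nat \<Rightarrow> nat) \<Rightarrow> nat \<Rightarrow> nat \<Rightarrow> bool" where
  "linked P c i j \<longleftrightarrow> i \<le> j \<and> (\<forall>m\<in>{i..<j}. c (m + 1) = c m + 2 \<and> c m + 1 \<in># P)"

text \<open>The count of \<open>c j + 1\<close> is \<open>0\<close> if the spread has odd length and \<open>c j\<close> is its last part.\<close>

definition pair_loss :: "nat multiset \<Rightarrow> (nat \<Rightarrow> nat) \<Rightarrow> nat \<Rightarrow> nat \<Rightarrow> nat" where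
  "pair_loss P c i j =
     count P (c i) * (c i - 2 * (i - 1)) + count P (c j + 1) * (c j + 1 - 2 * (j - 1))"

lemma U_index_spaced:
  assumes "U_index m a" "1 \<le> i" "i \<le> j" "j \<le> m"
  shows "a i + 2 * (j - i) \<le> a j"
  using assms(3,4)
proof (induction j rule: dec_induct)
  case (step j)
  then have "a j + 1 < a (j + 1)" using assms(1,2) by (auto simp: U_index_def)
  with step show ?case by simp
qed simp

lemma U_index_less:
  assumes "U_index m a" "1 \<le> i" "i < j" "j \<le> m"
  shows "a i + 2 \<le> a j"
  using U_index_spaced[OF assms(1,2) less_imp_le[OF assms(3)] assms(4)] assms(3) by simp

lemma below_ge:
  assumes "1 \<le> i \<Longrightarrow> i \<le> m \<and> (\<forall>j\<in>{1..i}. a j + 1 < p)"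
  shows "i \<le> below m a p"
proof -
  have "card {1..i} \<le> card {i \<in> {1..m}. a i + 1 < p}"
    by (rule card_mono) (use assms in auto)
  then show ?thesis by (simp add: below_def)
qed

lemma below_le:
  assumes "\<And>j. i < j \<Longrightarrow> j \<le> m \<Longrightarrow> p \<le> a j + 1"
  shows "below m a p \<le> i"
proof -
  have "card {i \<in> {1..m}. a i + 1 < p} \<le> card {1..i}"
    by (rule card_mono) (use assms in \<open>auto simp: not_less[symmetric]\<close>)
  then show ?thesis by (simp add: below_def)
qed

text \<open>Dominoes increase with their index, so those below \<open>p\<close> form an initial
  segment of the indices, and their number determines which they are.\<close>

lemma below_iff:
  assumes "U_index m a" "1 \<le> i"
  shows "i \<le> below m a p \<longleftrightarrow> i \<le> m \<and> a i + 1 < p"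
proof
  assume R: "i \<le> m \<and> a i + 1 < p"
  have "a j + 1 < p" if "j \<in> {1..i}" for j
    using U_index_spaced[OF assms(1), of j i] that R by auto
  with R show "i \<le> below m a p" by (intro below_ge) auto
next
  assume L: "i \<le> below m a p"
  show "i \<le> m \<and> a i + 1 < p"
  proof (rule ccontr)
    assume N: "\<not> ?thesis"
    have "p \<le> a j + 1" if "i - 1 < j" "j \<le> m" for j
    proof -
      have "i \<le> j" using that(1) by linarith
      then show ?thesis using N U_index_spaced[OF assms, of j] that(2) by auto
    qed
    then have "below m a p \<le> i - 1" by (rule below_le)
    with L assms(2) show False by simp
  qed
qed

text \<open>The hypotheses put \<open>p\<close> into the gap just before domino \<open>i\<close>, so
  \<open>p\<close> is uncovered with at most \<open>i - 1\<close> dominoes below it.\<close>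

lemma part_loss_ge:
  assumes "\<And>j. i \<le> j \<Longrightarrow> j \<le> m \<Longrightarrow> p < a j"
    and "\<And>j. 1 \<le> j \<Longrightarrow> j < i \<Longrightarrow> a j + 1 < p"
  shows "p - 2 * (i - 1) \<le> part_loss m a p"
proof -
  have "p < a j \<or> a j + 1 < p" if "j \<in> {1..m}" for j
    using assms[of j] that by (cases "i \<le> j") auto
  then have "\<not> covered m a p" unfolding covered_def by force
  moreover have "below m a p \<le> i - 1"
  proof (rule below_le)
    fix j assume "i - 1 < j" "j \<le> m"
    then show "p \<le> a j + 1" using assms(1)[of j] by linarith
  qed
  ultimately show ?thesis by (simp add: part_loss_def)
qed

section \<open>Cardinality of a U-chain\<close>

text \<open>If \<open>p\<close> lies in domino \<open>i\<close>, that domino supplies the inner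
  range from \<open>i\<close> to \<open>p + 1 - i\<close>, and the earlier dominoes, with index
  \<open>u\<close> or \<open>p + 1 - u\<close>, supply the outer values. Otherwise each domino
  \<open>i\<close> below \<open>p\<close> removes only \<open>u = i\<close> and
  \<open>u = p + 1 - i\<close>, which leaves a centred interval. Listing \<open>p\<close> first
  gives a dependent product that can be counted.\<close>

lemma U_chain_complement:
  assumes "U_index m a"
  shows "poset_D P - U_chain P m a =
    (\<lambda>(p, u, k). (u, p, k)) ` (SIGMA p:set_mset P.
       {u. \<not> covered m a p \<and> below m a p < u \<and> u \<le> p - below m a p} \<times> {1..count P p})"
    (is "?L = ?f ` ?S")
proof -
  have *: "(u, p, k) \<in> U_chain P m a \<longleftrightarrow>
      covered m a p \<or> u \<le> below m a p \<or> p - below m a p < u"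
    if D: "(u, p, k) \<in> poset_D P" for u p k
  proof (cases "covered m a p")
    case True
    then obtain i where i: "i \<in> {1..m}" "p \<in> {a i, a i + 1}" by (auto simp: covered_def)
    from D have u: "1 \<le> u" "u \<le> p" by (auto simp: poset_D_def)
    have le: "a j + 1 < p" if "1 \<le> j" "j < i" for j
      using U_index_less[OF assms that] i by auto
    consider "i \<le> u" "u + i \<le> p + 1" | "u < i" | "1 \<le> p + 1 - u" "p + 1 - u < i"
      using u by linarith
    then have "\<exists>j\<in>{1..m}. (u, p, k) \<in> U_part P a j"
    proof cases
      case 1
      then show ?thesis using i D by (intro bexI[of _ i]) (auto simp: U_part_def)
    next
      case 2
      then show ?thesis using i D u le[of u] by (intro bexI[of _ u]) (auto simp: U_part_def)
    next
      case 3
      then show ?thesis using i D u le[of "p + 1 - u"]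
        by (intro bexI[of _ "p + 1 - u"]) (auto simp: U_part_def)
    qed
    with True show ?thesis by (auto simp: U_chain_def)
  next
    case False
    from D have u: "1 \<le> u" "u \<le> p" by (auto simp: poset_D_def)
    have "(u, p, k) \<in> U_chain P m a \<longleftrightarrow>
        (\<exists>i\<in>{1..m}. a i + 1 < p \<and> (u = i \<or> u + i = p + 1))"
      using D False by (auto simp: U_chain_def U_part_def covered_def)
    also have "\<dots> \<longleftrightarrow> (\<exists>i. 1 \<le> i \<and> i \<le> below m a p \<and> (u = i \<or> u + i = p + 1))"
      using below_iff[OF assms, of _ p] by (metis atLeastAtMost_iff)
    also have "\<dots> \<longleftrightarrow> u \<le> below m a p \<or> p - below m a p < u"
    proof
      assume "u \<le> below m a p \<or> p - below m a p < u"
      then show "\<exists>i. 1 \<le> i \<and> i \<le> below m a p \<and> (u = i \<or> u + i = p + 1)"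
      proof
        assume "p - below m a p < u"
        then show ?thesis using u by (intro exI[of _ "p + 1 - u"]) auto
      qed (use u in blast)
    qed auto
    finally show ?thesis using False by simp
  qed
  show ?thesis
  proof (intro set_eqI iffI)
    fix x assume "x \<in> ?L"
    then obtain u p k where x: "x = (u, p, k)" "(u, p, k) \<in> poset_D P"
      "(u, p, k) \<notin> U_chain P m a" by (cases x) auto
    then have "(p, u, k) \<in> ?S" using * by (auto simp: poset_D_def)
    then show "x \<in> ?f ` ?S" using x(1) by force
  next
    fix x assume "x \<in> ?f ` ?S"
    then obtain u p k where x: "x = (u, p, k)" "(p, u, k) \<in> ?S" by auto
    then have "(u, p, k) \<in> poset_D P" by (auto simp: poset_D_def)
    with x * show "x \<in> ?L" by auto
  qed
qed

lemma sum_mset_conv_sum_count: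
  fixes P :: "'a :: semiring_1 multiset"
  shows "sum_mset P = (\<Sum>p\<in>set_mset P. of_nat (count P p) * p)"
proof -
  \<comment> \<open>The index set is any finite superset, so that it stays fixed while the induction
    enlarges \<open>P\<close>.\<close>
  have "finite A \<Longrightarrow> set_mset P \<subseteq> A \<Longrightarrow> (\<Sum>p\<in>A. of_nat (count P p) * p) = sum_mset P" for A
  proof (induction P)
    case (add x P)
    have "(\<Sum>p\<in>A. of_nat (count (add_mset x P) p) * p) =
        (\<Sum>p\<in>A. (if p = x then p else 0) + of_nat (count P p) * p)"
      by (rule sum.cong) (auto simp: distrib_right)
    with add show ?case by (simp add: sum.distrib)
  qed simp
  then show ?thesis by simp
qed

lemma card_poset_D: "card (poset_D P) = sum_mset P"
proof -
  have "poset_D P =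
      (\<lambda>(p, u, k). (u, p, k)) ` (SIGMA p:set_mset P. {1..p} \<times> {1..count P p})"
    by (force simp: poset_D_def)
  then have "card (poset_D P) = card (SIGMA p:set_mset P. {1..p} \<times> {1..count P p})"
    by (simp add: card_image inj_on_def)
  also have "\<dots> = (\<Sum>p\<in>set_mset P. count P p * p)" by (simp add: mult.commute)
  also have "\<dots> = sum_mset P"
    by (simp add: sum_mset_conv_sum_count)
  finally show ?thesis .
qed

text \<open>Turns maximal U-chains into families of least loss; from here on only losses are
  compared.\<close>

lemma card_U_chain:
  assumes "U_index m a"
  shows "card (U_chain P m a) + loss P m a = sum_mset P"
proof -
  let ?S = "\<lambda>p. {u. \<not> covered m a p \<and> below m a p < u \<and> u \<le> p - below m a p}"
  have S: "?S p = (if covered m a p then {} else {below m a p<..p - below m a p})" for p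
    by auto
  have fin: "finite (?S p)" and card: "card (?S p) = part_loss m a p" for p
    unfolding S part_loss_def by auto
  have "card (poset_D P - U_chain P m a) =
      card (SIGMA p:set_mset P. ?S p \<times> {1..count P p})"
    unfolding U_chain_complement[OF assms] by (rule card_image) (auto simp: inj_on_def)
  also have "\<dots> = (\<Sum>p\<in>set_mset P. card (?S p \<times> {1..count P p}))"
    by (rule card_SigmaI) (use fin in auto)
  also have "\<dots> = loss P m a"
    unfolding loss_def card_cartesian_product card by (simp add: mult.commute)
  finally show ?thesis
    using card_Diff_subset[OF finite_subset[OF U_chain_subset finite_poset_D] U_chain_subset, of P m a]
      card_mono[OF finite_poset_D U_chain_subset, of P m a]
    by (simp add: card_poset_D)
qed

text \<open>Removes the special case \<open>k = 0\<close>, which does occur: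
  \<open>r - 1 = 0\<close> when one domino covers \<open>P\<close>.\<close>

lemma u_max_Max: "u_max P k = Max {card (U_chain P k a) | a. U_index k a}"
proof (cases "k = 0")
  case True
  have "{card (U_chain P 0 a) | a. U_index 0 a} = {0}"
    by (auto simp: U_chain_def U_index_def)
  with True show ?thesis by (simp add: u_max_def)
qed (simp add: u_max_def)

lemma u_max_ge:
  assumes "U_index k a"
  shows "sum_mset P \<le> u_max P k + loss P k a"
proof -
  have "card (U_chain P k a) \<le> u_max P k"
    unfolding u_max_Max by (rule Max_ge[OF finite_U_cards]) (use assms in blast)
  with card_U_chain[OF assms, of P] show ?thesis by linarith
qed

lemma u_max_attained:
  obtains a where "U_index k a" "u_max P k + loss P k a = sum_mset P"
proof -
  have "u_max P k \<in> {card (U_chain P k a) | a. U_index k a}"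
    unfolding u_max_Max by (rule Max_in[OF finite_U_cards U_cards_nonempty])
  then show ?thesis using card_U_chain that by fastforce
qed

section \<open>Exchanging tails with the full cover\<close>

text \<open>
  The two new families arise from \<open>b\<close> and the cover \<open>c\<close> by exchanging their tails at a place
  where \<open>c\<close> is exactly one domino ahead. As \<open>c\<close> loses nothing, each part loses in at most one of
  them, and there no more than it did for \<open>b\<close>.
\<close>

lemma exchange:
  assumes c: "domino_cover P r c" and b: "U_index k b" and k: "k < r"
  obtains b' d where "U_index (Suc k) b'" "U_index (r - 1) d"
    "loss P (Suc k) b' + loss P (r - 1) d \<le> loss P k b"
proof -
  have U: "U_index r c" using c by (simp add: domino_cover_def)
  \<comment> \<open>The first index at which \<open>b i\<close> lies beyond the whole domino at
    \<open>c i\<close>; \<open>Suc k\<close> is the sentinel for the case that \<open>b\<close> runs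
    out first.\<close>
  define i where "i = (LEAST i. 1 \<le> i \<and> (i = Suc k \<or> c i + 2 \<le> b i))"
  have i: "1 \<le> i" "i = Suc k \<or> c i + 2 \<le> b i"
    using LeastI[of "\<lambda>i. 1 \<le> i \<and> (i = Suc k \<or> c i + 2 \<le> b i)" "Suc k"] unfolding i_def by auto
  have ik: "i \<le> Suc k" unfolding i_def by (rule Least_le) simp
  have lt: "b j \<le> c j + 1" if "1 \<le> j" "j < i" for j
    using not_less_Least[of j "\<lambda>i. 1 \<le> i \<and> (i = Suc k \<or> c i + 2 \<le> b i)"] that
    unfolding i_def by auto
  have ge: "c i + 2 \<le> b j" if "i \<le> j" "j \<le> k" for j
    using U_index_spaced[OF b i(1) that] i(2) that by linarith
  \<comment> \<open>\<open>b'\<close> follows \<open>c\<close> through \<open>i\<close> and then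
    \<open>b\<close> delayed by one index; \<open>d\<close> follows \<open>b\<close> before
    \<open>i\<close> and then \<open>c\<close> advanced by one, so that \<open>c i\<close> is
    skipped.\<close>
  define b' where "b' j = (if j \<le> i then c j else b (j - 1))" for j
  define d where "d j = (if j < i then b j else c (j + 1))" for j
  have b': "U_index (Suc k) b'" unfolding U_index_def
  proof (intro allI impI)
    fix j assume j: "1 \<le> j \<and> j < Suc k"
    show "b' j + 1 < b' (j + 1)"
    proof (cases "j \<le> i")
      case False
      then have "b (j - 1) + 2 \<le> b j" using j i(1) by (intro U_index_less[OF b]) auto
      with False show ?thesis by (simp add: b'_def)
    next
      case True
      then show ?thesis using j k ge[of j] U_index_less[OF U, of j "j + 1"]
        by (cases "j = i") (auto simp: b'_def)
    qed
  qed
  have d: "U_index (r - 1) d" unfolding U_index_def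
  proof (intro allI impI)
    fix j assume j: "1 \<le> j \<and> j < r - 1"
    consider "j + 1 < i" | "j + 1 = i" | "i \<le> j" by linarith
    then show "d j + 1 < d (j + 1)"
    proof cases
      case 1
      then show ?thesis using j ik U_index_less[OF b, of j "j + 1"] by (auto simp: d_def)
    next
      case 2
      have "j + 2 \<le> r" using j by linarith
      then have "c j + 4 \<le> c (j + 2)" using j U_index_spaced[OF U, of j "j + 2"] by simp
      with 2 show ?thesis using j lt[of j] by (auto simp: d_def)
    next
      case 3
      have "j + 2 \<le> r" using j by linarith
      then show ?thesis using 3 U_index_less[OF U, of "j + 1" "j + 2"] by (auto simp: d_def)
    qed
  qed
  have "part_loss (Suc k) b' p + part_loss (r - 1) d p \<le> part_loss k b p" if p: "p \<in># P" for p
  proof -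
    from c p obtain n where n: "n \<in> {1..r}" "p = c n \<or> p = c n + 1"
      unfolding domino_cover_def covered_def by blast
    show ?thesis
    \<comment> \<open>Up to \<open>c i + 1\<close> the family \<open>b'\<close> covers like
      \<open>c\<close> and \<open>d\<close> behaves like \<open>b\<close>; beyond it the roles are
      reversed.\<close>
    proof (cases "p \<le> c i + 1")
      case True
      have "n \<le> i" using U_index_less[OF U i(1), of n] n True by (cases "n \<le> i") auto
      then have "covered (Suc k) b' p" using n ik
        unfolding covered_def by (intro bexI[of _ n]) (auto simp: b'_def)
      moreover have "covered (r - 1) d p" if "covered k b p"
      proof -
        from that obtain j where j: "j \<in> {1..k}" "p = b j \<or> p = b j + 1"
          by (auto simp: covered_def)
        then have "j < i" using ge[of j] True by (cases "j < i") auto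
        with j show ?thesis unfolding covered_def using k
          by (intro bexI[of _ j]) (auto simp: d_def)
      qed
      moreover have "below k b p \<le> below (r - 1) d p" unfolding below_def
      proof (rule card_mono)
        show "{i \<in> {1..k}. b i + 1 < p} \<subseteq> {i \<in> {1..r - 1}. d i + 1 < p}"
        proof safe
          fix j assume j: "j \<in> {1..k}" "b j + 1 < p"
          then have "j < i" using ge[of j] True by (cases "j < i") auto
          with j k show "j \<in> {1..r - 1}" "d j + 1 < p" by (auto simp: d_def)
        qed
      qed simp
      ultimately show ?thesis by (auto simp: part_loss_def)
    next
      case False
      have "i < n" using U_index_spaced[OF U, of n i] ik k n False by (cases "i < n") auto
      then have "covered (r - 1) d p" using n ik i(1)
        unfolding covered_def by (intro bexI[of _ "n - 1"]) (auto simp: d_def)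
      moreover have "covered (Suc k) b' p" if "covered k b p"
      proof -
        from that obtain j where j: "j \<in> {1..k}" "p = b j \<or> p = b j + 1"
          by (auto simp: covered_def)
        have "\<not> j < i"
        proof
          assume "j < i"
          then show False using lt[of j] j False U_index_less[OF U, of j i] ik k by auto
        qed
        with j show ?thesis unfolding covered_def
          by (intro bexI[of _ "Suc j"]) (auto simp: b'_def)
      qed
      moreover have "below k b p \<le> below (Suc k) b' p" unfolding below_def
      proof (rule card_inj_on_le)
        \<comment> \<open>Before \<open>i\<close> the dominoes of \<open>b\<close> are matched with
          those of \<open>c\<close>, which also lie below \<open>p\<close>; the later ones have
          moved up by one index.\<close>
        let ?f = "\<lambda>j. if j < i then j else Suc j"
        show "inj_on ?f {i \<in> {1..k}. b i + 1 < p}" by (auto simp: inj_on_def split: if_splits)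
        have "c j + 1 < p" if "1 \<le> j" "j < i" for j
          using U_index_less[OF U that] ik k False by auto
        then show "?f ` {i \<in> {1..k}. b i + 1 < p} \<subseteq> {i \<in> {1..Suc k}. b' i + 1 < p}"
          by (auto simp: b'_def)
      qed simp
      ultimately show ?thesis by (auto simp: part_loss_def)
    qed
  qed
  then have "loss P (Suc k) b' + loss P (r - 1) d \<le> loss P k b"
    unfolding loss_def sum.distrib[symmetric]
    by (intro sum_mono) (simp flip: distrib_left)
  with b' d that show thesis by blast
qed

section \<open>Families one domino short of a cover\<close>

text \<open>Between \<open>c i\<close> and \<open>c j\<close> linked dominoes are adjacent. Shifting
  them up by one replaces the \<open>j - i + 1\<close> dominoes of this run by \<open>j - i\<close>
  dominoes that cover it except for its two ends \<open>c i\<close> and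
  \<open>c j + 1\<close>.\<close>

lemma loss_le_pair_loss:
  assumes c: "domino_cover P r c" and l: "linked P c i j" and ij: "1 \<le> i" "j \<le> r"
  obtains d where "U_index (r - 1) d" "loss P (r - 1) d \<le> pair_loss P c i j"
proof -
  have U: "U_index r c" using c by (simp add: domino_cover_def)
  have le: "i \<le> j" and link: "\<And>m. i \<le> m \<Longrightarrow> m < j \<Longrightarrow> c (m + 1) = c m + 2"
    using l by (auto simp: linked_def)
  define d where "d m = (if m < i then c m else if m < j then c m + 1 else c (m + 1))" for m
  have d: "U_index (r - 1) d" unfolding U_index_def
  proof (intro allI impI)
    fix m assume m: "1 \<le> m \<and> m < r - 1"
    have "c m + 2 \<le> c (m + 1)" "c (m + 1) + 2 \<le> c (m + 2)"
      using m U_index_less[OF U, of m "m + 1"] U_index_less[OF U, of "m + 1" "m + 2"] by auto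
    then show "d m + 1 < d (m + 1)" using le by (auto simp: d_def)
  qed
  have cov: "covered (r - 1) d p" if p: "p \<in># P" "p \<noteq> c i" "p \<noteq> c j + 1" for p
  proof -
    from c p obtain n where n: "n \<in> {1..r}" "p = c n \<or> p = c n + 1"
      unfolding domino_cover_def covered_def by blast
    consider "n < i" | "i \<le> n" "n < j" "p = c n + 1" | "i < n" "n \<le> j" "p = c n" | "j < n"
      using n p le by (metis leI le_neq_implies_less)
    then show ?thesis
    proof cases
      case 1
      then show ?thesis using n ij le unfolding covered_def
        by (intro bexI[of _ n]) (auto simp: d_def)
    next
      case 2
      then show ?thesis using n ij le unfolding covered_def
        by (intro bexI[of _ n]) (auto simp: d_def)
    next
      case 3
      then show ?thesis using n ij le link[of "n - 1"] unfolding covered_def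
        by (intro bexI[of _ "n - 1"]) (auto simp: d_def)
    next
      case 4
      then show ?thesis using n ij le unfolding covered_def
        by (intro bexI[of _ "n - 1"]) (auto simp: d_def)
    qed
  qed
  have di: "part_loss (r - 1) d (c i) \<le> c i - 2 * (i - 1)"
  proof -
    have "i - 1 \<le> below (r - 1) d (c i)"
      by (rule below_ge) (use U_index_less[OF U, of _ i] ij le in \<open>auto simp: d_def Suc_le_eq\<close>)
    then show ?thesis by (auto simp: part_loss_def)
  qed
  have dj: "part_loss (r - 1) d (c j + 1) \<le> c j + 1 - 2 * (j - 1)"
  proof -
    have "d m + 1 < c j + 1" if "m \<in> {1..j - 1}" for m
      using U_index_less[OF U, of m j] ij le that by (auto simp: d_def)
    then have "j - 1 \<le> below (r - 1) d (c j + 1)"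
      by (intro below_ge) (use ij in auto)
    then show ?thesis by (auto simp: part_loss_def)
  qed
  let ?g = "\<lambda>p. count P p * part_loss (r - 1) d p"
  have ne: "c i \<noteq> c j + 1" using U_index_spaced[OF U ij(1) le ij(2)] by simp
  have "loss P (r - 1) d = sum ?g (set_mset P \<inter> {c i, c j + 1})"
    unfolding loss_def by (rule sum.mono_neutral_right) (use cov in \<open>auto simp: part_loss_def\<close>)
  also have "\<dots> \<le> sum ?g {c i, c j + 1}" by (rule sum_mono2) auto
  also have "\<dots> = ?g (c i) + ?g (c j + 1)" using ne by simp
  also have "\<dots> \<le> pair_loss P c i j"
    unfolding pair_loss_def using di dj by (intro add_mono mult_le_mono2)
  finally show thesis using d that by blast
qed

text \<open>
  Follow \<open>b\<close> and \<open>c\<close> until \<open>b\<close> first leaves \<open>c j + 1\<close> uncovered; going back from \<open>j\<close> through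
  the dominoes of \<open>b\<close> that are ahead of those of \<open>c\<close> leads to an uncovered \<open>c i\<close>.
\<close>

lemma pair_loss_le_loss:
  assumes c: "domino_cover P r c" and b: "U_index (r - 1) b" and r: "1 \<le> r"
  obtains i j where "linked P c i j" "1 \<le> i" "j \<le> r" "pair_loss P c i j \<le> loss P (r - 1) b"
proof -
  have U: "U_index r c" using c by (simp add: domino_cover_def)
  \<comment> \<open>\<open>j = r\<close> is the sentinel, as \<open>b\<close> has only
    \<open>r - 1\<close> dominoes. If \<open>c j + 1\<close> is not a part, it suffices that
    \<open>b j\<close> lies beyond \<open>c j\<close>.\<close>
  define J where "J j \<longleftrightarrow> 1 \<le> j \<and> (j = r \<or> (c j < b j \<and> (c j + 1 \<in># P \<longrightarrow> c j + 2 \<le> b j)))" for j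
  define j where "j = (LEAST j. J j)"
  have "J r" using r by (simp add: J_def)
  then have Jj: "J j" and jr: "j \<le> r" unfolding j_def by (auto intro: LeastI Least_le)
  have j1: "1 \<le> j" using Jj by (simp add: J_def)
  have before: "b m \<le> c m \<or> (b m = c m + 1 \<and> c m + 1 \<in># P)" if "1 \<le> m" "m < j" for m
    using not_less_Least[of m J] that jr unfolding j_def[symmetric] by (auto simp: J_def)
  \<comment> \<open>Besides being linked up to \<open>j\<close>, all these dominoes must be
    overtaken by those of \<open>b\<close>; the least such \<open>i\<close> is where
    \<open>b\<close> leaves \<open>c i\<close> uncovered.\<close>
  define I where "I i \<longleftrightarrow> 1 \<le> i \<and> i \<le> j \<and>
    (\<forall>m\<in>{i..<j}. c m < b m \<and> c (m + 1) = c m + 2 \<and> c m + 1 \<in># P)" for i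
  define i where "i = (LEAST i. I i)"
  have "I j" using j1 by (simp add: I_def)
  then have Ii: "I i" unfolding i_def by (rule LeastI)
  then have i1: "1 \<le> i" and ij: "i \<le> j" by (auto simp: I_def)
  have link: "linked P c i j" using Ii by (auto simp: I_def linked_def)
  have bi: "c i < b i" if "i \<le> r - 1"
    using Ii Jj that r by (cases "i = j") (auto simp: I_def J_def)
  \<comment> \<open>By minimality the run cannot be extended to \<open>i - 1\<close>. Either
    \<open>b (i - 1)\<close> has not passed \<open>c (i - 1)\<close>, or it equals
    \<open>c (i - 1) + 1\<close> and then \<open>c i\<close> is at least
    \<open>c (i - 1) + 3\<close>.\<close>
  have pre: "b (i - 1) + 1 < c i" if "1 < i"
  proof -
    have "\<not> I (i - 1)" using not_less_Least[of "i - 1" I] that unfolding i_def[symmetric] by simp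
    moreover have "{i - 1..<j} = insert (i - 1) {i..<j}" using ij that by auto
    ultimately have "\<not> (c (i - 1) < b (i - 1) \<and> c i = c (i - 1) + 2 \<and> c (i - 1) + 1 \<in># P)"
      using Ii that by (auto simp: I_def)
    moreover have "c (i - 1) + 2 \<le> c i" using U_index_less[OF U, of "i - 1" i] that ij jr by simp
    moreover have "b (i - 1) \<le> c (i - 1) \<or> (b (i - 1) = c (i - 1) + 1 \<and> c (i - 1) + 1 \<in># P)"
      using that ij by (intro before) linarith+
    ultimately show ?thesis by (elim disjE conjE) auto
  qed
  have li: "c i - 2 * (i - 1) \<le> part_loss (r - 1) b (c i)"
  proof -
    have hi: "c i < b m" if "i \<le> m" "m \<le> r - 1" for m
      using U_index_spaced[OF b i1 that] bi that by simp
    have lo: "b m + 1 < c i" if "1 \<le> m" "m < i" for m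
    proof -
      have "m \<le> i - 1" "i - 1 \<le> r - 1" using that ij jr by linarith+
      from U_index_spaced[OF b that(1) this] pre that show ?thesis by linarith
    qed
    show ?thesis by (rule part_loss_ge[OF hi lo])
  qed
  have lj: "c j + 1 - 2 * (j - 1) \<le> part_loss (r - 1) b (c j + 1)" if "c j + 1 \<in># P"
  proof -
    have hi: "c j + 1 < b m" if m: "j \<le> m" "m \<le> r - 1" for m
      using U_index_spaced[OF b j1 m] Jj m r \<open>c j + 1 \<in># P\<close> by (auto simp: J_def)
    have lo: "b m + 1 < c j + 1" if "1 \<le> m" "m < j" for m
      using before[OF that] U_index_less[OF U that jr] by auto
    show ?thesis by (rule part_loss_ge[OF hi lo])
  qed
  let ?g = "\<lambda>p. count P p * part_loss (r - 1) b p"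
  have ne: "c i \<noteq> c j + 1" using U_index_spaced[OF U i1 ij jr] by simp
  \<comment> \<open>The bound \<open>lj\<close> is available only if \<open>c j + 1\<close> is a
    part; otherwise its multiplicity is 0.\<close>
  have "pair_loss P c i j \<le> ?g (c i) + ?g (c j + 1)"
    unfolding pair_loss_def using li lj
    by (cases "c j + 1 \<in># P") (auto simp: not_in_iff intro!: add_mono mult_le_mono2)
  also have "\<dots> = sum ?g {c i, c j + 1}" using ne by simp
  also have "\<dots> = sum ?g (set_mset P \<inter> {c i, c j + 1})"
    by (rule sum.mono_neutral_right) (auto simp: not_in_iff)
  also have "\<dots> \<le> loss P (r - 1) b"
    unfolding loss_def by (rule sum_mono2) auto
  finally show thesis using link i1 jr that by blast
qed

section \<open>The smallest part of \<open>lambda_U\<close>\<close>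

text \<open>The cover loses nothing, so \<open>u_max P\<close> is constant from \<open>r\<close> on
  and entry \<open>r\<close> is the least loss of \<open>r - 1\<close> dominoes. Positivity of the
  pair losses makes this entry nonzero, hence a candidate for \<open>min_part\<close>.\<close>

lemma min_part_lambda_U:
  assumes c: "domino_cover P r c" and r: "1 \<le> r"
    and pos: "\<And>i j. 1 \<le> i \<Longrightarrow> j \<le> r \<Longrightarrow> linked P c i j \<Longrightarrow> 0 < pair_loss P c i j"
  obtains i j where "1 \<le> i" "j \<le> r" "linked P c i j" "min_part (lambda_U P) = pair_loss P c i j"
    "\<And>i j. 1 \<le> i \<Longrightarrow> j \<le> r \<Longrightarrow> linked P c i j \<Longrightarrow> min_part (lambda_U P) \<le> pair_loss P c i j"
proof -
  let ?n = "sum_mset P"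
  have le_n: "u_max P k \<le> ?n" for k
    using u_max_attained[of k P] by (metis le_add1)
  have "loss P r c = 0" using c by (simp add: loss_def domino_cover_def part_loss_def)
  then have ur: "u_max P r = ?n"
    using u_max_ge[of r c P] c le_n[of r] by (simp add: domino_cover_def)
  have un: "u_max P k = ?n" if "r \<le> k" for k
    using lift_Suc_mono_le[of "u_max P", OF u_max_mono that] ur le_n[of k] by simp
  have lam_r: "lambda_U P r = ?n - u_max P (r - 1)" by (simp add: lambda_U_def ur)
  obtain b where b: "U_index (r - 1) b" "u_max P (r - 1) + loss P (r - 1) b = ?n"
    by (rule u_max_attained)
  obtain i j where ij: "linked P c i j" "1 \<le> i" "j \<le> r" "pair_loss P c i j \<le> loss P (r - 1) b"
    by (rule pair_loss_le_loss[OF c b(1) r])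
  have min: "lambda_U P r \<le> pair_loss P c i j" if h: "1 \<le> i" "j \<le> r" "linked P c i j" for i j
  proof -
    obtain d where "U_index (r - 1) d" "loss P (r - 1) d \<le> pair_loss P c i j"
      by (rule loss_le_pair_loss[OF c h(3,1,2)])
    with u_max_ge[of "r - 1" d P] lam_r show ?thesis by simp
  qed
  have eq: "lambda_U P r = pair_loss P c i j"
    using min[OF ij(2,3,1)] ij(4) b(2) lam_r by simp
  have "0 < lambda_U P r" using pos[OF ij(2,3,1)] eq by simp
  \<comment> \<open>A nonzero entry has \<open>k - 1 < r\<close>, so \<open>exchange\<close> applies
    to an optimal family of \<open>k - 1\<close> dominoes; its inequality, rewritten with
    \<open>u_max\<close>, is the claim.\<close>
  have lam_le: "lambda_U P r \<le> lambda_U P k" if k: "1 \<le> k" "lambda_U P k \<noteq> 0" for k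
  proof -
    have kr: "k - 1 < r"
      using k un[of k] un[of "k - 1"] by (cases "k - 1 < r") (auto simp: lambda_U_def)
    obtain b where b: "U_index (k - 1) b" "u_max P (k - 1) + loss P (k - 1) b = ?n"
      by (rule u_max_attained)
    obtain b' d where "U_index (Suc (k - 1)) b'" "U_index (r - 1) d"
      "loss P (Suc (k - 1)) b' + loss P (r - 1) d \<le> loss P (k - 1) b"
      by (rule exchange[OF c b(1) kr])
    moreover have "Suc (k - 1) = k" using k(1) by simp
    ultimately have "?n \<le> u_max P k + loss P k b'" "?n \<le> u_max P (r - 1) + loss P (r - 1) d"
      "loss P k b' + loss P (r - 1) d \<le> loss P (k - 1) b" by (auto intro: u_max_ge)
    with b(2) show ?thesis unfolding lambda_U_def ur by linarith
  qed
  have "min_part (lambda_U P) = lambda_U P r" unfolding min_part_def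
  proof (rule Min_eqI)
    have "{lambda_U P k |k. 1 \<le> k \<and> lambda_U P k \<noteq> 0} \<subseteq> {..?n}"
      using le_n by (auto simp: lambda_U_def intro: diff_le_self le_trans)
    then show "finite {lambda_U P k |k. 1 \<le> k \<and> lambda_U P k \<noteq> 0}"
      by (rule finite_subset) simp
  qed (use lam_le r \<open>0 < lambda_U P r\<close> in auto)
  with eq ij min that show thesis by simp
qed

section \<open>\<open>r_P\<close> and \<open>mu_spread\<close> for a single spread\<close>

text \<open>Grouping consecutive part sizes in pairs attains the bound, and an almost rectangular
  partition has at most two part sizes, so fewer groups cannot suffice.\<close>

lemma r_P_spread:
  assumes "set_mset Q = {p..<p + s}"
  shows "r_P Q = (s + 1) div 2"
  unfolding r_P_def
proof (rule Least_equality)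
  define F where "F i = filter_mset (\<lambda>x. x = p + 2 * i \<or> x = p + 2 * i + 1) Q" for i
  define M where "M = image_mset F (mset_set {..<(s + 1) div 2})"
  have "(\<Sum>i<n. count (F i) x) = (if x < p + 2 * n then count Q x else 0)" for n x
  proof (induction n)
    case 0
    then show ?case using assms by (auto simp: not_in_iff[symmetric])
  next
    case (Suc n)
    then show ?case by (auto simp: F_def)
  qed
  then have "count (\<Sum>\<^sub># M) x = count Q x" for x
    unfolding M_def using assms
    by (auto simp: count_sum not_in_iff[symmetric] simp flip: sum_unfold_sum_mset)
  then have "\<Sum>\<^sub># M = Q" by (rule multiset_eqI)
  moreover have "almost_rectangular (F i)" if "i < (s + 1) div 2" for i
  proof -
    have sub: "set_mset (F i) \<subseteq> {p + 2 * i, p + 2 * i + 1}" by (auto simp: F_def)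
    have ne: "p + 2 * i \<in># F i" using that assms by (auto simp: F_def)
    have "Max (set_mset (F i)) \<le> p + 2 * i + 1"
      using ne sub by (subst Max_le_iff) auto
    moreover have "p + 2 * i \<le> Min (set_mset (F i))"
      using ne sub by (subst Min_ge_iff) auto
    ultimately show ?thesis using ne by (auto simp: almost_rectangular_def)
  qed
  ultimately show "\<exists>M. \<Sum>\<^sub># M = Q \<and> (\<forall>Q\<in>#M. almost_rectangular Q) \<and> size M = (s + 1) div 2"
    by (intro exI[of _ M]) (auto simp: M_def)
next
  fix k assume "\<exists>M. \<Sum>\<^sub># M = Q \<and> (\<forall>Q\<in>#M. almost_rectangular Q) \<and> size M = k"
  then obtain M where M: "\<Sum>\<^sub># M = Q" "\<forall>Q\<in>#M. almost_rectangular Q" "size M = k" by blast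
  have "card (set_mset A) \<le> 2" if "almost_rectangular A" for A
  proof -
    have "set_mset A \<subseteq> {Min (set_mset A)..Min (set_mset A) + 1}"
    proof
      fix x assume x: "x \<in># A"
      then have "x \<le> Max (set_mset A)" "Min (set_mset A) \<le> x" by simp_all
      with that show "x \<in> {Min (set_mset A)..Min (set_mset A) + 1}"
        by (auto simp: almost_rectangular_def)
    qed
    from card_mono[OF _ this] show ?thesis by simp
  qed
  with M(2) have "card (set_mset (\<Sum>\<^sub># M)) \<le> 2 * size M"
  proof (induction M)
    case (add A M)
    have "card (set_mset (\<Sum>\<^sub># (add_mset A M))) \<le> card (set_mset A) + card (set_mset (\<Sum>\<^sub># M))"
      by (simp add: card_Un_le)
    moreover have "card (set_mset A) \<le> 2" using add.prems by simp
    moreover have "card (set_mset (\<Sum>\<^sub># M)) \<le> 2 * size M" using add by simp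
    ultimately show ?case by simp
  qed simp
  then show "(s + 1) div 2 \<le> k" using M assms by simp
qed

text \<open>With indices from 0, the two multiplicities belong to the first element of greedy domino
  \<open>t\<close> and the second element of greedy domino \<open>t'\<close>. Since
  \<open>d \<le> p\<close>, the shift merges no parts.\<close>

lemma mu_spread_shift_down:
  assumes Q: "set_mset Q = {p..<p + s}" and s: "1 \<le> s" and d: "d \<le> p"
  shows "mu_spread (shift_down Q d) =
    Min {(p - d) * count Q (p + 2 * t) + (p - d + 1) * count Q (p + 2 * t' + 1) | t t'.
           t \<le> t' \<and> t' < (s + 1) div 2}"
proof -
  have set: "set_mset (shift_down Q d) = {p - d..<p - d + s}"
  proof -
    have "(\<lambda>x. x - d) ` {p..<p + s} = {p - d..<p - d + s}"
    proof safe
      fix x assume "x \<in> {p - d..<p - d + s}"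
      then show "x \<in> (\<lambda>x. x - d) ` {p..<p + s}"
        using d by (intro image_eqI[of _ _ "x + d"]) auto
    qed (use d in auto)
    then show ?thesis by (simp add: shift_down_def Q)
  qed
  have Min: "Min (set_mset (shift_down Q d)) = p - d"
    unfolding set using s by (intro Min_eqI) auto
  have count: "count (shift_down Q d) y = count Q (y + d)" for y
  proof -
    have "{x \<in> set_mset Q. y = x - d} = (if y + d \<in># Q then {y + d} else {})"
      using Q d by auto
    then show ?thesis
      by (auto simp: shift_down_def count_image_mset' not_in_iff)
  qed
  have odd: "spread_mult (shift_down Q d) (2 * i - 1) = count Q (p + 2 * (i - 1))"
    and even: "spread_mult (shift_down Q d) (2 * i) = count Q (p + 2 * (i - 1) + 1)" if "1 \<le> i" for i
    unfolding spread_mult_def Min count using that d by (auto intro!: arg_cong[where f = "count Q"])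
  have "{(p - d) * spread_mult (shift_down Q d) (2 * i - 1) +
         (p - d + 1) * spread_mult (shift_down Q d) (2 * j) | i j.
            1 \<le> i \<and> i \<le> j \<and> j \<le> (s + 1) div 2} =
        {(p - d) * count Q (p + 2 * t) + (p - d + 1) * count Q (p + 2 * t' + 1) | t t'.
           t \<le> t' \<and> t' < (s + 1) div 2}" (is "?L = ?R")
  proof (intro set_eqI iffI)
    fix x assume "x \<in> ?L"
    then obtain i j where ij: "1 \<le> i" "i \<le> j" "j \<le> (s + 1) div 2"
      "x = (p - d) * spread_mult (shift_down Q d) (2 * i - 1) +
         (p - d + 1) * spread_mult (shift_down Q d) (2 * j)" by blast
    have "i - 1 \<le> j - 1" "j - 1 < (s + 1) div 2" using ij(1-3) by linarith+
    moreover have "x = (p - d) * count Q (p + 2 * (i - 1)) + (p - d + 1) * count Q (p + 2 * (j - 1) + 1)"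
      unfolding ij(4) using odd[of i] even[of j] ij(1,2) by simp
    ultimately show "x \<in> ?R" by blast
  next
    fix x assume "x \<in> ?R"
    then obtain t t' where t: "t \<le> t'" "t' < (s + 1) div 2"
      "x = (p - d) * count Q (p + 2 * t) + (p - d + 1) * count Q (p + 2 * t' + 1)" by blast
    have "1 \<le> t + 1" "t + 1 \<le> t' + 1" "t' + 1 \<le> (s + 1) div 2" using t(1,2) by linarith+
    moreover have "x = (p - d) * spread_mult (shift_down Q d) (2 * (t + 1) - 1) +
         (p - d + 1) * spread_mult (shift_down Q d) (2 * (t' + 1))"
      unfolding t(3) using odd[of "t + 1"] even[of "t' + 1"] by simp
    ultimately show "x \<in> ?L" by blast
  qed
  then show ?thesis
    unfolding mu_spread_def Let_def Min r_P_spread[OF set] by simp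
qed

section \<open>The greedy cover of a partition\<close>

lemma count_sum_list:
  "count (sum_list Ps) x = (\<Sum>i<length Ps. count (Ps ! i) x)"
  by (simp add: sum_list_sum_nth count_sum lessThan_atLeast0)

text \<open>Identifies \<open>mu P\<close> with the least pair loss. Domino \<open>t\<close> of
  spread \<open>k\<close> has \<open>R k + t\<close> dominoes before it, so the offset
  \<open>2 * t\<close> cancels and the weights become \<open>p k - 2 * R k\<close> and its
  successor, as in the shifted spread.\<close>

lemma spread_decomp_cover:
  assumes "0 \<notin># P" "P \<noteq> {#}"
  obtains r c where "domino_cover P r c" "1 \<le> r"
    "\<And>i j. 1 \<le> i \<Longrightarrow> j \<le> r \<Longrightarrow> linked P c i j \<Longrightarrow> 0 < pair_loss P c i j"
    "\<And>i j. 1 \<le> i \<Longrightarrow> j \<le> r \<Longrightarrow> linked P c i j \<Longrightarrow> mu P \<le> pair_loss P c i j"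
    "\<exists>i j. 1 \<le> i \<and> j \<le> r \<and> linked P c i j \<and> mu P = pair_loss P c i j"
proof -
  define Ps where "Ps = spread_decomp P"
  define l where "l = length Ps"
  have dec: "is_spread_decomp P Ps"
    unfolding Ps_def spread_decomp_def by (rule theI'[OF ex1_spread_decomp[OF assms(1)]])
  then have "\<forall>k. \<exists>p s. k < l \<longrightarrow> 1 \<le> p \<and> 1 \<le> s \<and> set_mset (Ps ! k) = {p..<p + s}"
    unfolding is_spread_decomp_def is_spread_def l_def by (metis nth_mem)
  then obtain p s where ps: "\<And>k. k < l \<Longrightarrow> 1 \<le> p k" "\<And>k. k < l \<Longrightarrow> 1 \<le> s k"
    "\<And>k. k < l \<Longrightarrow> set_mset (Ps ! k) = {p k..<p k + s k}" by metis
  have P: "P = sum_list Ps" and "l \<noteq> 0"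
    using dec assms(2) by (auto simp: is_spread_decomp_def l_def)
  have gap: "p k + s k + 1 \<le> p (Suc k)" if "Suc k < l" for k
  proof -
    have "p k + s k - 1 \<le> Max (set_mset (Ps ! k))"
      using that ps(2)[of k] by (intro Max_ge) (auto simp: ps(3))
    moreover have "Min (set_mset (Ps ! Suc k)) \<le> p (Suc k)"
      using that ps(2)[of "Suc k"] by (intro Min_le) (auto simp: ps(3))
    moreover have "Max (set_mset (Ps ! k)) + 2 \<le> Min (set_mset (Ps ! Suc k))"
      using dec that by (auto simp: is_spread_decomp_def l_def)
    ultimately show ?thesis by linarith
  qed
  have ord: "p k + s k + 1 \<le> p k'" if "k < k'" "k' < l" for k k'
    using that
  proof (induction k')
    case (Suc k')
    then show ?case using gap[of k'] by (cases "k = k'") auto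
  qed simp
  \<comment> \<open>The range includes the gap value \<open>p k + s k\<close>, which is the second
    element of the last domino when \<open>s k\<close> is odd.\<close>
  have count_P: "count P y = count (Ps ! k) y" if k: "k < l" "p k \<le> y" "y \<le> p k + s k" for k y
  proof -
    have "count (Ps ! i) y = 0" if "i < l" "i \<noteq> k" for i
      using k that ps(3)[of i] ord[of i k] ord[of k i]
      by (cases "i < k") (auto simp flip: not_in_iff)
    then have "(\<Sum>i<l. count (Ps ! i) y) = (\<Sum>i\<in>{k}. count (Ps ! i) y)"
      using k(1) by (intro sum.mono_neutral_right) auto
    then show ?thesis by (simp add: P count_sum_list l_def)
  qed
  have in_P: "y \<in># P \<longleftrightarrow> y < p k + s k" if "k < l" "p k \<le> y" "y \<le> p k + s k" for k y
    using count_P[OF that] that ps(3)[of k] by (auto simp flip: count_greater_zero_iff)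
  define R where "R = r_bar Ps"
  define h where "h k = (s k + 1) div 2" for k
  have R_0: "R 0 = 0" by (simp add: R_def r_bar_def)
  have R_Suc: "R (Suc k) = R k + h k" if "k < l" for k
    using r_P_spread[OF ps(3)[OF that]] by (simp add: R_def r_bar_def h_def)
  have R_mono: "R k \<le> R k'" if "k \<le> k'" for k k'
    unfolding R_def r_bar_def using that by (intro sum_mono2) auto
  have R_le: "R k + h k \<le> R l" if "k < l" for k
    using R_mono[of "Suc k" l] R_Suc[OF that] that by simp
  \<comment> \<open>Passing a spread raises \<open>2 * R k\<close> by at most
    \<open>s k + 1\<close>, and \<open>gap\<close> raises the smallest part by at least as
    much.\<close>
  have R_less: "2 * R k < p k" if "k < l" for k
    using that
  proof (induction k)
    case 0
    then show ?case using ps(1)[of 0] R_0 by simp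
  next
    case (Suc k)
    then show ?case using R_Suc[of k] gap[of k] by (simp add: h_def)
  qed
  have block: "\<exists>k<l. \<exists>t<h k. m = R k + t + 1" if "n \<le> l" "1 \<le> m" "m \<le> R n" for m n
    using that
  proof (induction n)
    case 0
    then show ?case using R_0 by simp
  next
    case (Suc n)
    show ?case
    proof (cases "m \<le> R n")
      case False
      then have "m - R n - 1 < h n" "m = R n + (m - R n - 1) + 1"
        using Suc.prems R_Suc[of n] by auto
      with Suc.prems show ?thesis by (meson Suc_le_eq)
    qed (use Suc in simp)
  qed
  \<comment> \<open>The least \<open>k\<close> selects the spread that contains domino number
    \<open>m\<close>; within it the dominoes advance by 2.\<close>
  define c where "c m = (let k = LEAST k. m \<le> R (Suc k) in p k + 2 * (m - 1 - R k))" for m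
  have c: "c (R k + t + 1) = p k + 2 * t" if "k < l" "t < h k" for k t
  proof -
    have "(LEAST k'. R k + t + 1 \<le> R (Suc k')) = k"
    proof (rule Least_equality)
      show "R k + t + 1 \<le> R (Suc k)" using R_Suc that by simp
      fix k' assume "R k + t + 1 \<le> R (Suc k')"
      then show "k \<le> k'" using R_mono[of "Suc k'" k] by (cases "k \<le> k'") auto
    qed
    then show ?thesis by (simp add: c_def)
  qed
  have inner: "c (R k + t + 2) = c (R k + t + 1) + 2" "c (R k + t + 1) + 1 \<in># P"
    if "k < l" "t + 1 < h k" for k t
  proof -
    show "c (R k + t + 2) = c (R k + t + 1) + 2"
      using c[of k "t + 1"] c[of k t] that by simp
    show "c (R k + t + 1) + 1 \<in># P"
      using c[of k t] that in_P[of k "p k + 2 * t + 1"] by (auto simp: h_def)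
  qed
  \<comment> \<open>Across a gap, a difference of exactly 2 forces \<open>s k\<close> to be odd, and
    then \<open>c (R k + h k) + 1\<close> is the gap value. Hence the membership condition in
    \<open>linked\<close> separates spreads.\<close>
  have outer: "c (R k + h k) + 2 \<le> c (R k + h k + 1)"
      "c (R k + h k + 1) = c (R k + h k) + 2 \<Longrightarrow> c (R k + h k) + 1 \<notin># P"
    if k: "k < l" "R k + h k < R l" for k
  proof -
    have h: "1 \<le> h k" using ps(2)[OF k(1)] by (simp add: h_def)
    have "Suc k \<noteq> l" using k R_Suc[of k] by auto
    with k have k': "Suc k < l" by simp
    have c1: "c (R k + h k) = p k + 2 * (h k - 1)" using c[of k "h k - 1"] k h by simp
    have "0 < h (Suc k)" using ps(2)[OF k'] by (simp add: h_def)
    then have c2: "c (R k + h k + 1) = p (Suc k)" using c[of "Suc k" 0] k' R_Suc[of k] by simp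
    show "c (R k + h k) + 2 \<le> c (R k + h k + 1)"
      unfolding c1 c2 using gap[OF k'] ps(2)[OF k(1)] h by (simp add: h_def)
    assume "c (R k + h k + 1) = c (R k + h k) + 2"
    then have "c (R k + h k) + 1 = p k + s k"
      unfolding c1 c2 using gap[OF k'] ps(2)[OF k(1)] h by (simp add: h_def)
    then show "c (R k + h k) + 1 \<notin># P" using in_P[of k "p k + s k"] k by simp
  qed
  have U: "U_index (R l) c" unfolding U_index_def
  proof (intro allI impI)
    fix m assume m: "1 \<le> m \<and> m < R l"
    then obtain k t where k: "k < l" "t < h k" "m = R k + t + 1" using block[of l m] by auto
    show "c m + 1 < c (m + 1)"
    proof (cases "t + 1 < h k")
      case True
      then show ?thesis using inner[of k t] k by simp
    next
      case False
      then have "m = R k + h k" using k by simp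
      then show ?thesis using outer(1)[OF k(1)] m by simp
    qed
  qed
  have cover: "domino_cover P (R l) c"
    unfolding domino_cover_def
  proof (intro conjI U allI impI)
    fix y assume "y \<in># P"
    then obtain k where k: "k < l" "y \<in># Ps ! k"
      by (auto simp: P l_def in_set_conv_nth)
    then have y: "p k \<le> y" "y < p k + s k" using ps(3) by auto
    define t where "t = (y - p k) div 2"
    have t: "t < h k" unfolding t_def h_def using y by linarith
    have "y = p k + 2 * t \<or> y = p k + 2 * t + 1" unfolding t_def using y by linarith
    then show "covered (R l) c y"
      unfolding covered_def using c[OF k(1) t] R_le[OF k(1)] t
      by (intro bexI[of _ "R k + t + 1"]) auto
  qed
  have linkedI: "linked P c (R k + t + 1) (R k + t' + 1)" if "k < l" "t \<le> t'" "t' < h k" for k t t'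
    unfolding linked_def
  proof (intro conjI ballI)
    fix m assume m: "m \<in> {R k + t + 1..<R k + t' + 1}"
    define u where "u = m - R k - 1"
    have "m = R k + u + 1" "u + 1 < h k" using m that by (auto simp: u_def)
    then show "c (m + 1) = c m + 2" "c m + 1 \<in># P" using inner[of k u] that by simp_all
  qed (use that in simp)
  \<comment> \<open>By \<open>outer\<close> a linked run cannot leave the spread in which it
    starts.\<close>
  have linkedD: "\<exists>k<l. \<exists>t t'. t \<le> t' \<and> t' < h k \<and> i = R k + t + 1 \<and> j = R k + t' + 1"
    if i: "1 \<le> i" and l: "linked P c i j" and j: "j \<le> R l" for i j
  proof -
    have "i \<le> j" using l by (simp add: linked_def)
    then obtain k t where k: "k < l" "t < h k" "i = R k + t + 1" using block[of l i] i j by auto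
    have "linked P c i j \<Longrightarrow> j \<le> R l \<Longrightarrow> t + (j - i) < h k"
      using \<open>i \<le> j\<close>
    proof (induction j rule: dec_induct)
      case (step j)
      then have IH: "t + (j - i) < h k" by (auto simp: linked_def)
      have lj: "c (j + 1) = c j + 2" "c j + 1 \<in># P"
        using step by (auto simp: linked_def)
      have "t + (j - i) + 1 \<noteq> h k"
      proof
        assume "t + (j - i) + 1 = h k"
        then have "j = R k + h k" using step.hyps k(3) by simp
        then show False using outer(2)[of k] lj step.prems k(1) by simp
      qed
      with IH step.hyps show ?case by simp
    qed (use k in simp)
    then have "t + (j - i) < h k" using l j by simp
    then show ?thesis using k \<open>i \<le> j\<close>
      by (intro exI[of _ k] conjI exI[of _ t] exI[of _ "t + (j - i)"]) auto
  qed
  define v where "v k t t' = (p k - 2 * R k) * count (Ps ! k) (p k + 2 * t) +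
    (p k - 2 * R k + 1) * count (Ps ! k) (p k + 2 * t' + 1)" for k t t'
  have pair_loss: "pair_loss P c (R k + t + 1) (R k + t' + 1) = v k t t'"
    if "k < l" "t \<le> t'" "t' < h k" for k t t'
  proof -
    have "p k + 2 * t - 2 * (R k + t) = p k - 2 * R k"
      "p k + 2 * t' + 1 - 2 * (R k + t') = p k - 2 * R k + 1"
      using R_less[OF that(1)] by auto
    moreover have "count P (p k + 2 * t) = count (Ps ! k) (p k + 2 * t)"
      "count P (p k + 2 * t' + 1) = count (Ps ! k) (p k + 2 * t' + 1)"
      using that by (auto intro!: count_P simp: h_def)
    ultimately show ?thesis
      using that c[of k t] c[of k t'] by (simp add: pair_loss_def v_def mult.commute)
  qed
  \<comment> \<open>The first element of every greedy domino is a part, even if the second is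
    not.\<close>
  have v_pos: "0 < v k t t'" if "k < l" "t \<le> t'" "t' < h k" for k t t'
  proof -
    have "p k + 2 * t \<in># Ps ! k" using ps(3)[of k] that by (auto simp: h_def)
    then show ?thesis using R_less[OF that(1)] by (simp add: v_def)
  qed
  define V where "V k = {v k t t' | t t'. t \<le> t' \<and> t' < h k}" for k
  have V: "finite (V k)" "V k \<noteq> {}" if "k < l" for k
  proof -
    have "V k \<subseteq> (\<lambda>(t, t'). v k t t') ` ({..h k} \<times> {..h k})" by (force simp: V_def)
    then show "finite (V k)" by (rule finite_subset) simp
    have "0 < h k" using ps(2)[OF that] by (simp add: h_def)
    then show "V k \<noteq> {}" by (auto simp: V_def)
  qed
  have "mu_spread (shift_down (Ps ! k) (2 * R k)) = Min (V k)" if "k < l" for k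
    using mu_spread_shift_down[OF ps(3) ps(2), OF that that, of "2 * R k"] R_less[OF that]
    by (simp add: V_def v_def h_def)
  then have "mu P = Min {Min (V k) | k. k < l}"
    unfolding mu_def Let_def Ps_def[symmetric] l_def[symmetric] R_def[symmetric]
    by (intro arg_cong[where f = Min]) (auto, metis)
  also have "{Min (V k) | k. k < l} = (\<lambda>k. Min (V k)) ` {..<l}" by auto
  finally have mu: "mu P = Min ((\<lambda>k. Min (V k)) ` {..<l})" .
  show thesis
  proof (rule that)
    show "domino_cover P (R l) c" by (rule cover)
    have "1 \<le> h 0" using ps(2)[of 0] \<open>l \<noteq> 0\<close> by (simp add: h_def)
    then show "1 \<le> R l" using R_le[of 0] \<open>l \<noteq> 0\<close> by simp
  next
    fix i j assume "1 \<le> i" "j \<le> R l" "linked P c i j"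
    then obtain k t t' where k: "k < l" "t \<le> t'" "t' < h k" "i = R k + t + 1" "j = R k + t' + 1"
      using linkedD by blast
    then show "0 < pair_loss P c i j" using pair_loss v_pos by simp
    have "mu P \<le> Min (V k)" unfolding mu by (rule Min_le) (use k in auto)
    also have "\<dots> \<le> v k t t'" by (rule Min_le) (use k V in \<open>auto simp: V_def\<close>)
    finally show "mu P \<le> pair_loss P c i j" using pair_loss k by simp
  next
    have "mu P \<in> (\<lambda>k. Min (V k)) ` {..<l}" unfolding mu by (rule Min_in) (use \<open>l \<noteq> 0\<close> in auto)
    then obtain k where k: "k < l" "mu P = Min (V k)" by auto
    then have "mu P \<in> V k" using Min_in[OF V] by simp
    then obtain t t' where t: "t \<le> t'" "t' < h k" "mu P = v k t t'" by (auto simp: V_def)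
    show "\<exists>i j. 1 \<le> i \<and> j \<le> R l \<and> linked P c i j \<and> mu P = pair_loss P c i j"
      using linkedI[OF k(1) t(1,2)] pair_loss[OF k(1) t(1,2)] t R_le[OF k(1)]
      by (intro exI[of _ "R k + t + 1"] exI[of _ "R k + t' + 1"]) auto
  qed
qed

theorem theorem2p10:
  fixes P :: "nat multiset" and n :: nat
  assumes "n > 0" and "partition_of n P"
  shows "min_part (lambda_U P) = mu P"
proof -
  have "0 \<notin># P" "P \<noteq> {#}" using assms by (auto simp: partition_of_def)
  then obtain r c where c: "domino_cover P r c" "1 \<le> r"
    "\<And>i j. 1 \<le> i \<Longrightarrow> j \<le> r \<Longrightarrow> linked P c i j \<Longrightarrow> 0 < pair_loss P c i j"
    "\<And>i j. 1 \<le> i \<Longrightarrow> j \<le> r \<Longrightarrow> linked P c i j \<Longrightarrow> mu P \<le> pair_loss P c i j"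
    "\<exists>i j. 1 \<le> i \<and> j \<le> r \<and> linked P c i j \<and> mu P = pair_loss P c i j"
    by (rule spread_decomp_cover) blast
  obtain i j where "1 \<le> i" "j \<le> r" "linked P c i j" "min_part (lambda_U P) = pair_loss P c i j"
    and le: "\<And>i j. 1 \<le> i \<Longrightarrow> j \<le> r \<Longrightarrow> linked P c i j \<Longrightarrow> min_part (lambda_U P) \<le> pair_loss P c i j"
    by (rule min_part_lambda_U[OF c(1,2,3)]) auto
  then show ?thesis using c(4,5) by (metis le_antisym)
qed

end
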